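(* Let $G$ be a finite simple graph that is both $(P_3 \cup P_2)$-free and diamond-free, and let $\omega = \omega(G)$. Then $\chi(G) \leq \omega + 2$ if $\omega = 2$; $\chi(G) \leq \omega + 3$ if $\omega = 3$; $\chi(G) \leq \omega + 1$ if $\omega = 4$; and $G$ is perfect if $\omega \geq 5$.
   Context: A graph $G$ is $H$-free if $G$ contains no induced subgraph isomorphic to $H$. $P_n$ denotes the path on $n$ vertices; $P_3 \cup P_2$ is the disjoint union of a path on 3 vertices and a path on 2 vertices. The diamond is the graph obtained from the complete graph $K_4$ by deleting one edge. $\chi(G)$ is the chromatic number and $\omega(G)$ the clique number of $G$. A graph is perfect if every induced subgraph $H$ satisfies $\chi(H) = \omega(H)$. *)

theory Defs
  imports "HOL-Library.Ramsey"
begin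

text \<open>
  A graph is a vertex set together with a set of two-element sets of vertices;
  \<open>[V]\<^bsup>2\<^esup>\<close> is the \<^const>\<open>nsets\<close> notation for the set of two-element subsets of \<open>V\<close>.
\<close>

record 'a graph =
  verts :: "'a set"
  edges :: "'a set set"

definition finite_simple_graph :: "'a graph \<Rightarrow> bool" where
  "finite_simple_graph G \<longleftrightarrow> finite (verts G) \<and> edges G \<subseteq> [verts G]\<^bsup>2\<^esup>"

definition induced :: "'a graph \<Rightarrow> 'a set \<Rightarrow> 'a graph" where
  "induced G S = \<lparr>verts = S, edges = edges G \<inter> [S]\<^bsup>2\<^esup>\<rparr>"

definition isomorphic :: "'a graph \<Rightarrow> 'b graph \<Rightarrow> bool" where
  "isomorphic G H \<longleftrightarrow>
     (\<exists>f. bij_betw f (verts G) (verts H) \<and>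
          (\<forall>u\<in>verts G. \<forall>v\<in>verts G. {u, v} \<in> edges G \<longleftrightarrow> {f u, f v} \<in> edges H))"

definition free_of :: "'b graph \<Rightarrow> 'a graph \<Rightarrow> bool" where
  "free_of H G \<longleftrightarrow> \<not> (\<exists>S\<subseteq>verts G. isomorphic (induced G S) H)"

definition path_graph :: "nat \<Rightarrow> nat graph" where
  "path_graph n = \<lparr>verts = {..<n}, edges = {{i, Suc i} |i. Suc i < n}\<rparr>"

definition complete_graph :: "nat \<Rightarrow> nat graph" where
  "complete_graph n = \<lparr>verts = {..<n}, edges = [{..<n}]\<^bsup>2\<^esup>\<rparr>"

definition disjoint_union :: "'a graph \<Rightarrow> 'b graph \<Rightarrow> ('a + 'b) graph" where
  "disjoint_union G H =
     \<lparr>verts = verts G <+> verts H,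
      edges = (\<lambda>e. Inl ` e) ` edges G \<union> (\<lambda>e. Inr ` e) ` edges H\<rparr>"

definition delete_edge :: "'a graph \<Rightarrow> 'a set \<Rightarrow> 'a graph" where
  "delete_edge G e = \<lparr>verts = verts G, edges = edges G - {e}\<rparr>"

definition diamond :: "nat graph" where
  "diamond = delete_edge (complete_graph 4) {0, 1}"

definition proper_colouring :: "'a graph \<Rightarrow> nat \<Rightarrow> ('a \<Rightarrow> nat) \<Rightarrow> bool" where
  "proper_colouring G k c \<longleftrightarrow>
     c ` verts G \<subseteq> {..<k} \<and>
     (\<forall>u\<in>verts G. \<forall>v\<in>verts G. {u, v} \<in> edges G \<longrightarrow> c u \<noteq> c v)"

text \<open>
  The next three notions are meant for finite simple graphs only: for other graphs
  \<open>LEAST\<close> and \<^const>\<open>Max\<close> may range over an empty or an infinite set.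
\<close>

definition chromatic_number :: "'a graph \<Rightarrow> nat" where
  "chromatic_number G = (LEAST k. \<exists>c. proper_colouring G k c)"

definition clique_number :: "'a graph \<Rightarrow> nat" where
  "clique_number G = Max {card K |K. K \<subseteq> verts G \<and> clique K (edges G)}"

definition perfect :: "'a graph \<Rightarrow> bool" where
  "perfect G \<longleftrightarrow>
     (\<forall>S\<subseteq>verts G. chromatic_number (induced G S) = clique_number (induced G S))"

end

theory Submission
  imports Defs
begin

text \<open>
  Let \<open>K\<close> be a maximum clique. A vertex outside \<open>K\<close> has at most one neighbour in \<open>K\<close>, as two would
  create a diamond. An induced \<open>P\<^sub>3\<close> outside \<open>K\<close> therefore touches at most three vertices of \<open>K\<close>, and at
  most one vertex of \<open>K\<close> remains untouched; so for \<open>\<omega> \<ge> 5\<close> the graph \<open>G - K\<close> is a disjoint union of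
  cliques, and then every induced subgraph \<open>H\<close> is \<open>\<omega>(H)\<close>-colourable, without the strong perfect
  graph theorem.

  For \<open>\<omega> \<in> {3, 4}\<close>, let \<open>A\<^sub>0\<close> be the set of vertices without a neighbour in \<open>K\<close>. If \<open>A\<^sub>0\<close> contains an edge,
  then the remaining vertices outside \<open>K\<close> form a clique with it, so they are at most \<open>\<omega> - 2\<close> many
  and \<open>G - K\<close> is again a disjoint union of cliques. If \<open>A\<^sub>0\<close> is independent and \<open>\<omega> = 4\<close>, a greedy
  colouring in the order \<open>K\<close>, \<open>V - K - A\<^sub>0\<close>, \<open>A\<^sub>0\<close> needs five colours. If \<open>\<omega> = 3\<close>, take two vertices \<open>b\<close>, \<open>c\<close>
  of \<open>K\<close>: the sets \<open>N(b)\<close>, \<open>N(c)\<close> and the rest are disjoint unions of cliques with at most two vertices.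

  For \<open>\<omega> = 2\<close> and an induced path \<open>a - b - c\<close>, the sets \<open>N(a)\<close>, \<open>N(b)\<close>, \<open>N(c)\<close> and the rest are
  independent.
\<close>

section \<open>Small concrete graphs and an avoiding injection\<close>

lemma path_graph_2: "verts (path_graph 2) = {0, 1}" "edges (path_graph 2) = {{0, 1}}"
  and path_graph_3: "verts (path_graph 3) = {0, 1, 2}" "edges (path_graph 3) = {{0, 1}, {1, 2}}"
proof -
  have *: "Suc i < 3 \<longleftrightarrow> i = 0 \<or> i = 1" "Suc i < 2 \<longleftrightarrow> i = 0" for i by auto
  show "edges (path_graph 2) = {{0, 1}}" "edges (path_graph 3) = {{0, 1}, {1, 2}}"
    by (auto simp: path_graph_def * numeral_2_eq_2)
  show "verts (path_graph 2) = {0, 1}" "verts (path_graph 3) = {0, 1, 2}"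
    by (auto simp: path_graph_def)
qed

lemma edge_diamond_iff:
  "{i, j} \<in> edges diamond \<longleftrightarrow> i < 4 \<and> j < 4 \<and> i \<noteq> j \<and> {i, j} \<noteq> {0, 1}"
  by (auto simp: diamond_def delete_edge_def complete_graph_def nsets_def card_2_iff doubleton_eq_iff)

text \<open>Extend \<open>f\<close> from \<open>N\<close> to an injection of \<open>Q\<close> into
  the colours below \<open>m\<close>, then shift cyclically. This serves to colour a clique in which
  some vertices have one forbidden colour each, all distinct. For \<open>m = 1\<close> the shift
  would be the identity, hence the last assumption.\<close>

lemma inj_avoiding_exists:
  fixes f :: "'a \<Rightarrow> nat"
  assumes "finite Q" "card Q \<le> m" "N \<subseteq> Q" "inj_on f N" "f ` N \<subseteq> {..<m}" "N \<noteq> {} \<Longrightarrow> 2 \<le> m"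
  shows "\<exists>h. inj_on h Q \<and> h ` Q \<subseteq> {..<m} \<and> (\<forall>q\<in>N. h q \<noteq> f q)"
proof -
  have finN: "finite N" using assms finite_subset by blast
  have "card (Q - N) \<le> card ({..<m} - f ` N)"
    using assms finN by (simp add: card_Diff_subset card_image)
  then obtain g where g: "inj_on g (Q - N)" "g ` (Q - N) \<subseteq> {..<m} - f ` N"
    using assms(1) by (metis card_le_inj finite_Diff finite_lessThan)
  define e where "e q = (if q \<in> N then f q else g q)" for q
  have g': "g q < m \<and> (\<forall>x\<in>N. f x \<noteq> g q \<and> g q \<noteq> f x)" if "q \<in> Q" "q \<notin> N" for q
  proof -
    have "g q \<in> {..<m} - f ` N" using g(2) that by blast
    then show ?thesis by (auto simp: image_iff)
  qed
  have e: "e x \<noteq> e y" if "x \<in> Q" "y \<in> Q" "x \<noteq> y" for x y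
    using that g'[of x] g'[of y] inj_onD[OF assms(4), of x y] inj_onD[OF g(1), of x y]
    by (cases "x \<in> N"; cases "y \<in> N") (auto simp: e_def)
  have em: "e q < m" if "q \<in> Q" for q
    using that assms(5) g'[of q] unfolding e_def by (cases "q \<in> N") auto
  \<comment> \<open>a cyclic shift moves every colour\<close>
  define h where "h q = (if Suc (e q) = m then 0 else Suc (e q))" for q
  have "inj_on h Q"
    by (rule inj_onI, rule ccontr) (use e in \<open>auto simp: h_def split: if_splits\<close>)
  moreover have "h ` Q \<subseteq> {..<m}"
    using em by (auto simp: h_def intro!: Suc_lessI)
  moreover have "h q \<noteq> f q" if "q \<in> N" for q
  proof -
    have "2 \<le> m" using assms(6) that by blast
    then show ?thesis using that by (auto simp: h_def e_def)
  qed
  ultimately show ?thesis by blast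
qed

section \<open>Colourings, cliques and chromatic numbers\<close>

locale simple_graph =
  fixes G :: "'a graph"
  assumes simple: "finite_simple_graph G"
begin

abbreviation V where "V \<equiv> verts G"

abbreviation adj (infix "\<sim>" 50) where "u \<sim> v \<equiv> {u, v} \<in> edges G"

abbreviation colourable where "colourable S k \<equiv> \<exists>c. proper_colouring (induced G S) k c"

abbreviation clq where "clq K \<equiv> clique K (edges G)"

definition cliques_le where "cliques_le S m \<longleftrightarrow> (\<forall>K\<subseteq>S. clq K \<longrightarrow> card K \<le> m)"

text \<open>Absence of an induced \<open>P\<^sub>3\<close>: the graph on \<open>S\<close> is a
  disjoint union of cliques.\<close>

definition cluster where
  "cluster S \<longleftrightarrow> (\<forall>x\<in>S. \<forall>y\<in>S. \<forall>z\<in>S. x \<sim> y \<and> y \<sim> z \<and> x \<noteq> z \<longrightarrow> x \<sim> z)"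

lemma finite_V: "finite V" and edges_sub: "edges G \<subseteq> [V]\<^bsup>2\<^esup>"
  using simple by (auto simp: finite_simple_graph_def)

lemma adj_in_V: "u \<sim> v \<Longrightarrow> u \<in> V" "u \<sim> v \<Longrightarrow> v \<in> V" and not_adj_refl [simp]: "{u} \<notin> edges G"
  and adj_neq: "u \<sim> v \<Longrightarrow> u \<noteq> v"
  using edges_sub by (auto simp: nsets_def)

lemma adj_sym: "u \<sim> v \<Longrightarrow> v \<sim> u"
  by (simp add: insert_commute)

lemma induced_V: "induced G V = G"
  using edges_sub by (simp add: induced_def Int_absorb2)

lemma edge_induced_iff: "\<lbrakk>u \<in> S; v \<in> S\<rbrakk> \<Longrightarrow> {u, v} \<in> edges (induced G S) \<longleftrightarrow> u \<sim> v"
  by (cases "u = v") (simp_all add: induced_def nsets_def)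

lemma proper_colouring_induced:
  "proper_colouring (induced G S) k c \<longleftrightarrow>
    c ` S \<subseteq> {..<k} \<and> (\<forall>u\<in>S. \<forall>v\<in>S. u \<sim> v \<longrightarrow> c u \<noteq> c v)"
proof -
  have "verts (induced G S) = S" by (simp add: induced_def)
  then show ?thesis unfolding proper_colouring_def by (simp add: edge_induced_iff)
qed

lemma colourableE:
  assumes "colourable S k"
  obtains c where "c ` S \<subseteq> {..<k}" "\<forall>u\<in>S. \<forall>v\<in>S. u \<sim> v \<longrightarrow> c u \<noteq> c v"
  using assms unfolding proper_colouring_induced by auto

lemma colourableI:
  assumes "c ` S \<subseteq> {..<k}" "\<And>u v. \<lbrakk>u \<in> S; v \<in> S; u \<sim> v\<rbrakk> \<Longrightarrow> c u \<noteq> c v"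
  shows "colourable S k"
  using assms unfolding proper_colouring_induced by (intro exI[of _ c]) auto

lemma clique_induced_iff: "K \<subseteq> S \<Longrightarrow> clique K (edges (induced G S)) \<longleftrightarrow> clq K"
  unfolding clique_def by (meson edge_induced_iff subsetD)

lemma clique_insert: "\<lbrakk>clq K; \<And>x. x \<in> K \<Longrightarrow> x \<noteq> v \<Longrightarrow> v \<sim> x\<rbrakk> \<Longrightarrow> clq (insert v K)"
  unfolding clique_def by (metis adj_sym insert_iff)

lemma clique_subset: "\<lbrakk>clq K; L \<subseteq> K\<rbrakk> \<Longrightarrow> clq L"
  unfolding clique_def by blast

lemma chromatic_number_le: "colourable S k \<Longrightarrow> chromatic_number (induced G S) \<le> k"
  unfolding chromatic_number_def by (rule Least_le)

lemma clique_number_bound: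
  assumes "S \<subseteq> V"
  shows "cliques_le S (clique_number (induced G S))"
    and "\<exists>K\<subseteq>S. clq K \<and> card K = clique_number (induced G S)"
proof -
  have eq: "{card K |K. K \<subseteq> verts (induced G S) \<and> clique K (edges (induced G S))}
      = card ` {K. K \<subseteq> S \<and> clq K}" (is "?A = ?B")
    using clique_induced_iff by (auto simp: induced_def)
  have fin: "finite ?B"
    using finite_subset[OF assms finite_V] by simp
  have ne: "card ({} :: 'a set) \<in> ?B" by (rule imageI) (simp add: clique_def)
  have "Max ?B \<in> ?B" using Max_in[OF fin] ne by blast
  then show "\<exists>K\<subseteq>S. clq K \<and> card K = clique_number (induced G S)"
    unfolding clique_number_def eq by auto
  show "cliques_le S (clique_number (induced G S))"
    unfolding clique_number_def eq cliques_le_def using Max_ge[OF fin] by blast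
qed

lemma colourable_imp_clique_le:
  assumes "colourable S k" "K \<subseteq> S" "clq K"
  shows "card K \<le> k"
proof -
  obtain c where "c ` S \<subseteq> {..<k}" "\<forall>u\<in>S. \<forall>v\<in>S. u \<sim> v \<longrightarrow> c u \<noteq> c v"
    by (rule colourableE[OF assms(1)])
  then have "inj_on c K" "c ` K \<subseteq> {..<k}"
    using assms(2,3) unfolding clique_def inj_on_def by (meson subsetD, blast)
  then show ?thesis using card_inj_on_le[of c K "{..<k}"] by simp
qed

lemma chromatic_eq_clique_number:
  assumes "S \<subseteq> V" "colourable S (clique_number (induced G S))"
  shows "chromatic_number (induced G S) = clique_number (induced G S)"
proof (rule antisym)
  obtain K where K: "K \<subseteq> S" "clq K" "card K = clique_number (induced G S)"
    using clique_number_bound(2)[OF assms(1)] by blast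
  have "colourable S (chromatic_number (induced G S))"
    unfolding chromatic_number_def using assms(2) by (rule LeastI)
  then show "clique_number (induced G S) \<le> chromatic_number (induced G S)"
    using colourable_imp_clique_le K by metis
qed (rule chromatic_number_le[OF assms(2)])

section \<open>Building colourings\<close>

lemma colourable_Un:
  assumes "colourable S k" "colourable T l"
  shows "colourable (S \<union> T) (k + l)"
proof -
  obtain c where c: "c ` S \<subseteq> {..<k}" "\<forall>u\<in>S. \<forall>v\<in>S. u \<sim> v \<longrightarrow> c u \<noteq> c v"
    by (rule colourableE[OF assms(1)])
  obtain d where d: "d ` T \<subseteq> {..<l}" "\<forall>u\<in>T. \<forall>v\<in>T. u \<sim> v \<longrightarrow> d u \<noteq> d v"
    by (rule colourableE[OF assms(2)])
  \<comment> \<open>The shift by \<open>k\<close> separates the palettes; \<open>c\<close> takes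
    precedence on the overlap, so \<open>S\<close> and \<open>T\<close> may intersect.\<close>
  define e where "e x = (if x \<in> S then c x else k + d x)" for x
  have cS: "c x < k" if "x \<in> S" for x using c(1) that by auto
  have dT: "d x < l" if "x \<in> T" for x using d(1) that by auto
  have "e x < k + l" if "x \<in> S \<union> T" for x
    using that cS[of x] dT[of x] unfolding e_def by auto
  moreover have "e u \<noteq> e v" if "u \<in> S \<union> T" "v \<in> S \<union> T" "u \<sim> v" for u v
  proof -
    have "c u \<noteq> c v" if "u \<in> S" "v \<in> S" using c(2) that \<open>u \<sim> v\<close> by blast
    moreover have "d u \<noteq> d v" if "u \<notin> S" "v \<notin> S"
      using d(2) that \<open>u \<in> S \<union> T\<close> \<open>v \<in> S \<union> T\<close> \<open>u \<sim> v\<close> by blast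
    ultimately show ?thesis using cS[of u] cS[of v] by (auto simp: e_def)
  qed
  ultimately show ?thesis by (intro colourableI[of e]) blast+
qed

lemma colourable_subset: "\<lbrakk>colourable T k; S \<subseteq> T\<rbrakk> \<Longrightarrow> colourable S k"
  by (erule colourableE, rule colourableI) blast+

lemma colourable_mono: "\<lbrakk>colourable S k; k \<le> l\<rbrakk> \<Longrightarrow> colourable S l"
  by (erule colourableE, rule colourableI) (auto simp: subset_iff)

lemma colourable_independent:
  assumes "\<And>u v. \<lbrakk>u \<in> S; v \<in> S\<rbrakk> \<Longrightarrow> \<not> u \<sim> v"
  shows "colourable S 1"
  using assms unfolding proper_colouring_induced by (intro exI[of _ "\<lambda>_. 0"]) auto

text \<open>The components of \<open>S\<close> are cliques without edges between them, so an
  injective choice from the lists on each clique suffices. The lists will later exclude colours used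
  on \<open>K\<close>.\<close>

lemma cluster_list_colouring:
  fixes L :: "'a \<Rightarrow> nat set"
  assumes "cluster S"
    and "\<And>Q. \<lbrakk>Q \<subseteq> S; clq Q\<rbrakk> \<Longrightarrow> \<exists>h. inj_on h Q \<and> (\<forall>q\<in>Q. h q \<in> L q)"
  shows "\<exists>c. (\<forall>x\<in>S. c x \<in> L x) \<and> (\<forall>u\<in>S. \<forall>v\<in>S. u \<sim> v \<longrightarrow> c u \<noteq> c v)"
proof -
  define cls where "cls x = {y \<in> S. y = x \<or> x \<sim> y}" for x
  have tr: "x \<sim> z" if "x \<in> S" "y \<in> S" "z \<in> S" "x \<sim> y" "y \<sim> z" "x \<noteq> z" for x y z
    using assms(1) that unfolding cluster_def by blast
  have cl: "clq (cls x)" if "x \<in> S" for x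
    unfolding clique_def cls_def using that tr adj_sym by blast
  have eq: "cls u = cls v" if "u \<in> S" "v \<in> S" "u \<sim> v" for u v
    unfolding cls_def using that tr adj_sym by blast
  have "\<exists>h. inj_on h (cls x) \<and> (\<forall>q\<in>cls x. h q \<in> L q)" if "x \<in> S" for x
    using assms(2)[OF _ cl[OF that]] unfolding cls_def by blast
  then have "\<exists>h. inj_on h Q \<and> (\<forall>q\<in>Q. h q \<in> L q)" if "Q \<in> cls ` S" for Q
    using that by blast
  \<comment> \<open>One injection per component rather than per vertex, so adjacent vertices are
    coloured by the same one.\<close>
  then obtain h where h: "\<And>Q. Q \<in> cls ` S \<Longrightarrow> inj_on (h Q) Q \<and> (\<forall>q\<in>Q. h Q q \<in> L q)"
    by metis
  have self: "x \<in> cls x" if "x \<in> S" for x using that by (simp add: cls_def)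
  have "h (cls u) u \<noteq> h (cls v) v" if "u \<in> S" "v \<in> S" "u \<sim> v" for u v
    using h[of "cls u"] eq[OF that] self that adj_neq unfolding inj_on_def by (metis imageI)
  moreover have "h (cls x) x \<in> L x" if "x \<in> S" for x
    using h[of "cls x"] self that by blast
  ultimately show ?thesis by (intro exI[of _ "\<lambda>x. h (cls x) x"]) blast
qed

lemma cluster_colourable:
  assumes "S \<subseteq> V" "cluster S" "cliques_le S m"
  shows "colourable S m"
proof -
  have "\<exists>h. inj_on h Q \<and> (\<forall>q\<in>Q. h q \<in> {..<m})" if Q: "Q \<subseteq> S" "clq Q" for Q
  proof -
    have "finite Q" using assms(1) Q(1) finite_subset[OF _ finite_V] by blast
    moreover have "card Q \<le> card {..<m}" using assms(3) Q unfolding cliques_le_def by simp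
    ultimately show ?thesis using card_le_inj[of Q "{..<m}"] by auto
  qed
  from cluster_list_colouring[OF assms(2) this] show ?thesis
    unfolding proper_colouring_induced by blast
qed

text \<open>Vertices of \<open>T\<close> are added one at a time; bounding degrees in all of
  \<open>S \<union> T\<close> makes the order irrelevant.\<close>

lemma colourable_greedy:
  assumes "colourable S k" "T \<subseteq> V" "\<And>v. v \<in> T \<Longrightarrow> card {w \<in> S \<union> T. v \<sim> w} < k"
  shows "colourable (S \<union> T) k"
proof -
  have "finite T" using assms(2) finite_V finite_subset by blast
  then show ?thesis using assms
  proof (induction T)
    case (insert v T)
    have fin: "finite {w \<in> S \<union> insert v T. x \<sim> w}" for x
      by (rule finite_subset[OF _ finite_V]) (auto intro: adj_in_V)
    have "card {w \<in> S \<union> T. x \<sim> w} < k" if "x \<in> T" for x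
    proof -
      have "card {w \<in> S \<union> T. x \<sim> w} \<le> card {w \<in> S \<union> insert v T. x \<sim> w}"
        by (rule card_mono[OF fin]) auto
      then show ?thesis using insert.prems(3)[of x] that by auto
    qed
    then have col: "colourable (S \<union> T) k"
      using insert.prems by (intro insert.IH) auto
    obtain c where c: "c ` (S \<union> T) \<subseteq> {..<k}"
        "\<forall>u\<in>S \<union> T. \<forall>w\<in>S \<union> T. u \<sim> w \<longrightarrow> c u \<noteq> c w"
      by (rule colourableE[OF col])
    show ?case
    proof (cases "v \<in> S")
      case True
      then show ?thesis using col by (simp add: insert_absorb)
    next
      case False
      let ?N = "{w \<in> S \<union> insert v T. v \<sim> w}"
      have "card (c ` ?N) < k"
        using card_image_le[OF fin] insert.prems(3)[of v] le_less_trans by blast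
      then have "\<not> {..<k} \<subseteq> c ` ?N"
        using card_mono[of "c ` ?N" "{..<k}"] fin by auto
      then obtain i where i: "i < k" "i \<notin> c ` ?N" by auto
      have "i \<noteq> c w" if "w \<in> S \<union> insert v T" "v \<sim> w" for w
        using i(2) that by blast
      then have "(c(v := i)) u \<noteq> (c(v := i)) w"
        if "u \<in> S \<union> insert v T" "w \<in> S \<union> insert v T" "u \<sim> w" for u w
        using that c(2)[rule_format, of u w] adj_sym[OF that(3)] adj_neq[OF that(3)] by (cases "u = v"; cases "w = v") auto
      moreover have "(c(v := i)) ` (S \<union> insert v T) \<subseteq> {..<k}"
        using c(1) i(1) by auto
      ultimately show ?thesis by (intro colourableI[of "c(v := i)"]) blast+
    qed
  qed simp
qed

end

section \<open>Forbidden subgraphs as closure rules; the case \<omega> = 2\<close>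

locale P3P2_diamond_free = simple_graph +
  assumes P3P2_free: "free_of (disjoint_union (path_graph 3) (path_graph 2)) G"
    and diamond_free: "free_of diamond G"
begin

lemma diamond_closed:
  assumes "a \<sim> b" "a \<sim> x" "b \<sim> x" "a \<sim> y" "b \<sim> y" "x \<noteq> y"
  shows "x \<sim> y"
proof (rule ccontr)
  assume nadj: "\<not> x \<sim> y"
  let ?S = "{x, y, a, b}"
  have d: "x \<noteq> a" "x \<noteq> b" "y \<noteq> a" "y \<noteq> b" "a \<noteq> b"
    using assms adj_neq by auto
  \<comment> \<open>The nonadjacent pair \<open>x\<close>, \<open>y\<close> must go to the deleted
    edge \<open>{0, 1}\<close>.\<close>
  define f where "f u = (if u = x then 0 else if u = y then 1 else if u = a then 2 else 3 :: nat)" for u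
  have f: "f x = 0" "f y = 1" "f a = 2" "f b = 3"
    using assms(6) d by (auto simp: f_def)
  have "bij_betw f ?S {..<4}"
    unfolding bij_betw_def inj_on_def using f by (auto simp: less_Suc_eq numeral_eq_Suc)
  then have "bij_betw f (verts (induced G ?S)) (verts diamond)"
    by (simp add: induced_def diamond_def delete_edge_def complete_graph_def)
  moreover have "\<forall>u\<in>?S. \<forall>v\<in>?S. {u, v} \<in> edges (induced G ?S) \<longleftrightarrow> {f u, f v} \<in> edges diamond"
    using assms assms(1-5)[THEN adj_sym] nadj nadj[unfolded insert_commute[of x]] f
    by (simp add: edge_induced_iff edge_diamond_iff doubleton_eq_iff)
  moreover have "?S \<subseteq> V" using assms adj_in_V by blast
  ultimately show False
    using diamond_free unfolding free_of_def isomorphic_def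
    by (metis (no_types, lifting) induced_def select_convs(1))
qed

lemma P3P2_closed:
  assumes "x \<sim> y" "y \<sim> z" "x \<noteq> z" "u \<sim> v"
    and "\<And>w. w \<in> {x, y, z} \<Longrightarrow> \<not> w \<sim> u \<and> \<not> w \<sim> v"
  shows "x \<sim> z"
proof (rule ccontr)
  assume nadj: "\<not> x \<sim> z"
  let ?S = "{x, y, z, u, v}"
  let ?H = "disjoint_union (path_graph 3) (path_graph 2)"
  have n: "\<not> x \<sim> u" "\<not> y \<sim> u" "\<not> z \<sim> u" "\<not> x \<sim> v" "\<not> y \<sim> v" "\<not> z \<sim> v"
    using assms(5) by auto
  have n': "\<not> u \<sim> x" "\<not> u \<sim> y" "\<not> u \<sim> z" "\<not> v \<sim> x" "\<not> v \<sim> y" "\<not> v \<sim> z" "\<not> z \<sim> x"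
    using n nadj adj_sym by blast+
  \<comment> \<open>A path vertex equal to one of \<open>u\<close>, \<open>v\<close> would be
    adjacent to the other.\<close>
  have d: "x \<noteq> y" "y \<noteq> z" "u \<noteq> v" "x \<noteq> u" "x \<noteq> v" "y \<noteq> u" "y \<noteq> v" "z \<noteq> u" "z \<noteq> v"
    using assms(1-4) assms(4)[THEN adj_sym] n by auto
  define f :: "'a \<Rightarrow> nat + nat" where
    "f w = (if w = x then Inl 0 else if w = y then Inl 1 else if w = z then Inl 2
       else if w = u then Inr 0 else Inr 1)" for w
  have f: "f x = Inl 0" "f y = Inl 1" "f z = Inl 2" "f u = Inr 0" "f v = Inr 1"
    using assms(3) d by (auto simp: f_def)
  have vH: "verts ?H = {Inl 0, Inl 1, Inl 2, Inr 0, Inr 1}"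
    and eH: "edges ?H = {{Inl 0, Inl 1}, {Inl 1, Inl 2}, {Inr 0, Inr 1}}"
    by (auto simp: disjoint_union_def path_graph_2 path_graph_3)
  have "bij_betw f ?S (verts ?H)"
    unfolding bij_betw_def inj_on_def vH using f by auto
  then have "bij_betw f (verts (induced G ?S)) (verts ?H)"
    by (simp add: induced_def)
  moreover have "\<forall>a\<in>?S. \<forall>b\<in>?S. {a, b} \<in> edges (induced G ?S) \<longleftrightarrow> {f a, f b} \<in> edges ?H"
    using assms(1-4) assms(1,2,4)[THEN adj_sym] nadj n n' f
    by (simp add: edge_induced_iff eH doubleton_eq_iff)
  moreover have "?S \<subseteq> V" using assms(1-4) adj_in_V by blast
  ultimately show False
    using P3P2_free unfolding free_of_def isomorphic_def
    by (metis (no_types, lifting) induced_def select_convs(1))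
qed

text \<open>For a path in the neighbourhood, the edge from \<open>a\<close> to its middle vertex has
  both ends as common neighbours.\<close>

lemma cluster_neighbours: "cluster {v. a \<sim> v}"
  unfolding cluster_def using diamond_closed adj_sym by blast

text \<open>An induced \<open>P\<^sub>3\<close> in this set would form a forbidden subgraph with the
  edge \<open>{b, c}\<close>.\<close>

lemma cluster_nonneighbours:
  assumes "b \<sim> c"
  shows "cluster {v \<in> V. \<not> b \<sim> v \<and> \<not> c \<sim> v}"
  unfolding cluster_def using P3P2_closed[OF _ _ _ assms] adj_sym by blast

lemma neighbours_colourable:
  assumes "cliques_le V (Suc m)"
  shows "colourable {v. a \<sim> v} m"
proof (rule cluster_colourable[OF _ cluster_neighbours])
  show "{v. a \<sim> v} \<subseteq> V" using adj_in_V by blast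
  show "cliques_le {v. a \<sim> v} m"
    unfolding cliques_le_def
  proof (intro allI impI)
    fix K assume K: "K \<subseteq> {v. a \<sim> v}" "clq K"
    show "card K \<le> m"
    \<comment> \<open>The empty clique is separate because \<open>a\<close> need not be a vertex of
      \<open>G\<close>.\<close>
    proof (cases "K = {}")
      case False
      then have "insert a K \<subseteq> V" using K adj_in_V by blast
      moreover have "clq (insert a K)" using K clique_insert by blast
      ultimately have "card (insert a K) \<le> Suc m" using assms unfolding cliques_le_def by blast
      moreover have "a \<notin> K" "finite K"
        using K(1) \<open>insert a K \<subseteq> V\<close> finite_subset[OF _ finite_V] by auto
      ultimately show ?thesis by simp
    qed simp
  qed
qed

lemma colourable_4_of_triangle_free:
  assumes "cliques_le V 2"
  shows "colourable V 4"
proof (cases "cluster V")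
  case True
  then have "colourable V 2" using cluster_colourable assms by blast
  then show ?thesis using colourable_mono[of V 2 4] by simp
next
  case False
  then obtain a b c where abc: "a \<sim> b" "b \<sim> c" "a \<noteq> c" "\<not> a \<sim> c"
    unfolding cluster_def by blast
  let ?N = "\<lambda>x. {v. x \<sim> v}"
  let ?I = "{v \<in> V. \<not> a \<sim> v \<and> \<not> b \<sim> v \<and> \<not> c \<sim> v}"
  \<comment> \<open>An edge in \<open>?I\<close> would complete the induced path \<open>a\<close>,
    \<open>b\<close>, \<open>c\<close> to a forbidden subgraph.\<close>
  have "colourable ?I 1"
    using P3P2_closed[OF abc(1-3)] abc(4) by (intro colourable_independent) blast
  moreover have "colourable (?N x) 1" for x
    using neighbours_colourable[of 1 x] assms by (simp add: numeral_2_eq_2)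
  ultimately have "colourable (?N a \<union> ?N b \<union> ?N c \<union> ?I) (1 + 1 + 1 + 1)"
    by (intro colourable_Un) auto
  then have "colourable (?N a \<union> ?N b \<union> ?N c \<union> ?I) 4" by (simp add: numeral_eq_Suc)
  then show ?thesis by (rule colourable_subset) blast
qed

end

section \<open>A maximum clique and the vertices outside it\<close>

locale with_max_clique = P3P2_diamond_free +
  fixes K :: "'a set"
  assumes K_sub: "K \<subseteq> V" and K_clique: "clq K" and K_max: "cliques_le V (card K)"
begin

lemma finite_K: "finite K" using K_sub finite_V finite_subset by blast

lemma K_adj: "\<lbrakk>k \<in> K; l \<in> K; k \<noteq> l\<rbrakk> \<Longrightarrow> k \<sim> l"
  using K_clique unfolding clique_def by blast

text \<open>If \<open>k \<noteq> l\<close>, every other vertex of \<open>K\<close> is, like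
  \<open>v\<close>, a common neighbour of \<open>k\<close> and \<open>l\<close>, hence adjacent to
  \<open>v\<close>; then \<open>v\<close> would enlarge \<open>K\<close>.\<close>

lemma neighbour_in_K_unique:
  assumes "v \<notin> K" "k \<in> K" "l \<in> K" "v \<sim> k" "v \<sim> l"
  shows "k = l"
proof (rule ccontr)
  assume "k \<noteq> l"
  then have "v \<sim> w" if "w \<in> K" for w
    using assms that diamond_closed[of k l v w] K_adj adj_sym by blast
  then have "clq (insert v K)" using K_clique clique_insert by blast
  moreover have "insert v K \<subseteq> V" using K_sub assms adj_in_V by blast
  ultimately have "card (insert v K) \<le> card K" using K_max unfolding cliques_le_def by blast
  then show False using assms finite_K by simp
qed

definition touching where "touching S = {k \<in> K. \<exists>v\<in>S. v \<sim> k}"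

lemma card_touching_le:
  assumes "finite S" "S \<inter> K = {}"
  shows "card (touching S) \<le> card S"
proof -
  have "card {k \<in> K. v \<sim> k} \<le> 1" if "v \<in> S" for v
    using neighbour_in_K_unique[of v] that assms finite_K by (auto simp: card_le_Suc0_iff_eq)
  moreover have "touching S = (\<Union>v\<in>S. {k \<in> K. v \<sim> k})" by (auto simp: touching_def)
  ultimately show ?thesis
    using card_UN_le[OF assms(1), of "\<lambda>v. {k \<in> K. v \<sim> k}"] sum_mono[of S "\<lambda>v. card {k \<in> K. v \<sim> k}" "\<lambda>_. 1"]
    by simp
qed

text \<open>Two vertices of \<open>K\<close> outside \<open>M\<close> supply the
  \<open>P\<^sub>2\<close>. Any superset \<open>M\<close> of the touched vertices will do, so rough
  bounds suffice.\<close>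

lemma P3_outside_closed:
  assumes "x \<sim> y" "y \<sim> z" "x \<noteq> z" "touching {x, y, z} \<subseteq> M" "finite M" "card M + 2 \<le> card K"
  shows "x \<sim> z"
proof -
  have "2 \<le> card (K - M)" using assms(5,6) diff_card_le_card_Diff[of M K] by linarith
  then obtain k l where "k \<in> K - M" "l \<in> K - M" "k \<noteq> l"
    by (metis card_2_iff insert_subset obtain_subset_with_card_n)
  then show ?thesis
    using P3P2_closed[OF assms(1-3), of k l] K_adj assms(4) unfolding touching_def by blast
qed

text \<open>
  Colour \<open>H \<inter> K\<close> injectively; every component \<open>Q\<close> of \<open>H - K\<close> is then coloured on its own, since
  either some vertex of \<open>K\<close> is complete to \<open>Q\<close>, or distinct vertices of \<open>Q\<close> avoid distinct colours.
\<close>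

lemma colourable_of_cluster_outside:
  assumes "cluster (V - K)" "H \<subseteq> V" "cliques_le H m"
  shows "colourable H m"
proof -
  have finH: "finite H" using assms(2) finite_V finite_subset by blast
  have KH: "clq (K \<inter> H)" using K_clique clique_subset by blast
  then have "card (K \<inter> H) \<le> card {..<m}" using assms(3) unfolding cliques_le_def by simp
  then obtain c :: "'a \<Rightarrow> nat" where c: "c ` (K \<inter> H) \<subseteq> {..<m}" "inj_on c (K \<inter> H)"
    using card_le_inj finH by (metis finite_Int finite_lessThan)
  \<comment> \<open>The colours left for \<open>q\<close> once \<open>K \<inter> H\<close> is
    coloured.\<close>
  define L where "L q = {i. i < m \<and> (\<forall>k\<in>K \<inter> H. q \<sim> k \<longrightarrow> c k \<noteq> i)}" for q
  have "\<exists>h. inj_on h Q \<and> (\<forall>q\<in>Q. h q \<in> L q)" if Q: "Q \<subseteq> H - K" "clq Q" for Q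
  proof -
    have finQ: "finite Q" using Q finH finite_subset by blast
    have uniq: "k = l" if "q \<in> Q" "k \<in> K \<inter> H" "l \<in> K \<inter> H" "q \<sim> k" "q \<sim> l" for q k l
      using neighbour_in_K_unique that Q by blast
    show ?thesis
    proof (cases "\<exists>k\<in>K \<inter> H. \<exists>x\<in>Q. \<exists>y\<in>Q. x \<noteq> y \<and> x \<sim> k \<and> y \<sim> k")
      case True
      then obtain k x y where k: "k \<in> K \<inter> H" "x \<in> Q" "y \<in> Q" "x \<noteq> y" "x \<sim> k" "y \<sim> k" by blast
      have Qadj: "u \<sim> v" if "u \<in> Q" "v \<in> Q" "u \<noteq> v" for u v
        using Q that unfolding clique_def by blast
      have kQ: "k \<notin> Q" using k Q by blast
      \<comment> \<open>Both \<open>z\<close> and \<open>k\<close> are common neighbours of the edge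
        \<open>{x, y}\<close>. So \<open>k\<close> extends \<open>Q\<close> to a clique of
        \<open>H\<close>, which leaves enough colours besides \<open>c k\<close>, the only forbidden
        one.\<close>
      have all: "z \<sim> k" if "z \<in> Q" for z
        using that k kQ Qadj diamond_closed[of x y z k] by (cases "z = x \<or> z = y") auto
      then have "clq (insert k Q)" using Q(2) by (intro clique_insert) (auto simp: insert_commute)
      moreover have "insert k Q \<subseteq> H" using k Q by blast
      ultimately have "card (insert k Q) \<le> m" using assms(3) unfolding cliques_le_def by blast
      then have "card Q \<le> card ({..<m} - {c k})"
        using kQ finQ c k by (auto simp: card_Diff_singleton_if)
      then obtain h where "h ` Q \<subseteq> {..<m} - {c k}" "inj_on h Q"
        using card_le_inj finQ by (metis finite_Diff finite_lessThan)
      moreover have "l = k" if "q \<in> Q" "l \<in> K \<inter> H" "q \<sim> l" for q l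
        using uniq that k all by blast
      ultimately show ?thesis unfolding L_def by (intro exI[of _ h]) blast
    next
      case False
      define N where "N = {q \<in> Q. \<exists>k\<in>K \<inter> H. q \<sim> k}"
      have "\<forall>q\<in>N. \<exists>k. k \<in> K \<inter> H \<and> q \<sim> k" unfolding N_def by blast
      then obtain n where n: "\<And>q. q \<in> N \<Longrightarrow> n q \<in> K \<inter> H \<and> q \<sim> n q"
        by (auto dest!: bchoice)
      \<comment> \<open>No two vertices of \<open>Q\<close> share a neighbour in
        \<open>K \<inter> H\<close>, so their forbidden colours differ.\<close>
      have "inj_on (c \<circ> n) N"
      proof (rule comp_inj_on)
        show "inj_on n N" using False n unfolding inj_on_def N_def by (metis (no_types, lifting) mem_Collect_eq)
        show "inj_on c (n ` N)" using c(2) n by (meson image_subsetI inj_on_subset)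
      qed
      \<comment> \<open>The edge from \<open>q\<close> to \<open>n q\<close> is a clique of
        \<open>H\<close>.\<close>
      moreover have "2 \<le> m" if ne: "N \<noteq> {}"
      proof -
        obtain q where q: "q \<in> N" using ne by blast
        then have ends: "clq {q, n q}" "{q, n q} \<subseteq> H" "q \<noteq> n q"
          using n[OF q] Q unfolding clique_def N_def by (auto simp: insert_commute)
        then have "card {q, n q} \<le> m" using assms(3) unfolding cliques_le_def by blast
        then show ?thesis using ends(3) by simp
      qed
      moreover have "card Q \<le> m" using assms(3) Q unfolding cliques_le_def by blast
      moreover have "(c \<circ> n) ` N \<subseteq> {..<m}" using n c(1) by auto
      moreover have "N \<subseteq> Q" unfolding N_def by blast
      ultimately obtain h where h: "inj_on h Q" "h ` Q \<subseteq> {..<m}" "\<forall>q\<in>N. h q \<noteq> (c \<circ> n) q"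
        using inj_avoiding_exists[OF finQ, of m N "c \<circ> n"] by blast
      have "c k \<noteq> h q" if "q \<in> Q" "k \<in> K \<inter> H" "q \<sim> k" for q k
      proof -
        have "q \<in> N" using that unfolding N_def by blast
        then have "k = n q" using uniq[of q k "n q"] n that by blast
        then show ?thesis using h(3) \<open>q \<in> N\<close> by fastforce
      qed
      then show ?thesis using h unfolding L_def by (intro exI[of _ h]) auto
    qed
  qed
  moreover have "cluster (H - K)" using assms(1,2) unfolding cluster_def by blast
  ultimately have "\<exists>d. (\<forall>x\<in>H - K. d x \<in> L x) \<and> (\<forall>u\<in>H - K. \<forall>v\<in>H - K. u \<sim> v \<longrightarrow> d u \<noteq> d v)"
    by (intro cluster_list_colouring)
  then obtain d where d: "\<forall>x\<in>H - K. d x \<in> L x"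
      "\<forall>u\<in>H - K. \<forall>v\<in>H - K. u \<sim> v \<longrightarrow> d u \<noteq> d v"
    by blast
  define e where "e x = (if x \<in> K then c x else d x)" for x
  have "e ` H \<subseteq> {..<m}" using c(1) d(1) unfolding e_def L_def by auto
  moreover have "e u \<noteq> e v" if uv: "u \<in> H" "v \<in> H" "u \<sim> v" for u v
  proof -
    have "c u \<noteq> c v" if "u \<in> K" "v \<in> K"
      using c(2) adj_neq[OF uv(3)] that uv unfolding inj_on_def by blast
    moreover have "c u \<noteq> d v" if "u \<in> K" "v \<notin> K"
      using d(1) uv that adj_sym[OF uv(3)] unfolding L_def by blast
    moreover have "d u \<noteq> c v" if "u \<notin> K" "v \<in> K"
      using d(1) uv that unfolding L_def by (metis (mono_tags, lifting) DiffI IntI mem_Collect_eq)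
    ultimately show ?thesis using d(2) uv unfolding e_def by auto
  qed
  ultimately show ?thesis unfolding proper_colouring_induced by blast
qed

definition A0 where "A0 = {v \<in> V - K. \<forall>k\<in>K. \<not> v \<sim> k}"

lemma cluster_outside_of_edge:
  assumes "3 \<le> card K" "y \<in> A0" "z \<in> A0" "y \<sim> z"
  shows "cluster (V - K)"
proof -
  define A where "A = V - K - A0"
  have both: "p \<sim> y \<and> p \<sim> z" if pA: "p \<in> A" for p
  proof -
    obtain k where k: "k \<in> K" "p \<sim> k" and p: "p \<notin> K" using pA unfolding A_def A0_def by blast
    have "K \<noteq> {k}" using assms(1) by auto
    then obtain l where l: "l \<in> K" "l \<noteq> k" using k by blast
    have "\<not> p \<sim> l" using neighbour_in_K_unique k l p by blast
    moreover have "p \<noteq> l" using l p by blast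
    \<comment> \<open>The path \<open>p\<close>, \<open>k\<close>, \<open>l\<close> is induced, and
      \<open>k\<close>, \<open>l\<close> have no neighbour among \<open>y\<close>,
      \<open>z\<close>.\<close>
    ultimately have "\<exists>w\<in>{p, k, l}. w \<sim> y \<or> w \<sim> z"
      using P3P2_closed[OF k(2) K_adj[OF k(1) l(1)], of y z] assms(4) l by blast
    then have or: "p \<sim> y \<or> p \<sim> z"
      using assms(2,3) k l adj_sym unfolding A0_def by blast
    \<comment> \<open>Adjacency to one end of the edge gives adjacency to the other: the resulting
      path touches only \<open>k\<close>, leaving two vertices of \<open>K\<close> free.\<close>
    have "touching {p, y, z} \<subseteq> {k}" "touching {p, z, y} \<subseteq> {k}"
      using assms(2,3) k p neighbour_in_K_unique unfolding touching_def A0_def by blast+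
    moreover have "p \<noteq> y" "p \<noteq> z" using pA assms unfolding A_def by auto
    ultimately show ?thesis
      using or P3_outside_closed[of p y z "{k}"] P3_outside_closed[of p z y "{k}"] assms(1,4)
        assms(4)[THEN adj_sym] by auto
  qed
  have AV: "A \<subseteq> V" and finA: "finite A" unfolding A_def using finite_V by auto
  have "clq A"
    unfolding clique_def using both diamond_closed[OF assms(4)] adj_sym by blast
  then have "clq (insert y (insert z A))"
    using both assms(4) by (intro clique_insert) (auto simp: insert_commute)
  moreover have "insert y (insert z A) \<subseteq> V" using assms(4) AV adj_in_V by blast
  ultimately have "card (insert y (insert z A)) \<le> card K" using K_max unfolding cliques_le_def by blast
  moreover have "y \<notin> A" "z \<notin> A" "y \<noteq> z" using assms(2-4) unfolding A_def by auto
  ultimately have "card A + 2 \<le> card K" using finA by simp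
  moreover have "card (touching A) \<le> card A" using card_touching_le finA unfolding A_def by blast
  ultimately have le: "card (touching A) + 2 \<le> card K" by simp
  have fin: "finite (touching A)" using finite_K unfolding touching_def by simp
  \<comment> \<open>Vertices of \<open>A0\<close> touch nothing, so a single set \<open>M\<close>
    serves all paths outside \<open>K\<close>.\<close>
  have "touching {u, v, w} \<subseteq> touching A" if "u \<in> V - K" "v \<in> V - K" "w \<in> V - K" for u v w
    using that unfolding touching_def A_def A0_def by blast
  then show ?thesis
    unfolding cluster_def using P3_outside_closed[OF _ _ _ _ fin le] by blast
qed

text \<open>The bound is three vertices touched by a path plus two for a free edge.\<close>

lemma cluster_outside_of_card_ge_5:
  assumes "5 \<le> card K"
  shows "cluster (V - K)"
  unfolding cluster_def
proof (intro ballI impI)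
  fix x y z assume xyz: "x \<in> V - K" "y \<in> V - K" "z \<in> V - K" "x \<sim> y \<and> y \<sim> z \<and> x \<noteq> z"
  have "card (touching {x, y, z}) \<le> card {x, y, z}" using xyz by (intro card_touching_le) auto
  also have "\<dots> \<le> 3" by (simp add: card_insert_if)
  finally have "card (touching {x, y, z}) + 2 \<le> card K" using assms by simp
  moreover have "finite (touching {x, y, z})" using finite_K unfolding touching_def by simp
  ultimately show "x \<sim> z" using P3_outside_closed xyz(4) by blast
qed

section \<open>The case \<omega> = 3\<close>

lemma colourable_6_of_card_3:
  assumes "card K = 3"
  shows "colourable V 6"
proof (cases "\<exists>y\<in>A0. \<exists>z\<in>A0. y \<sim> z")
  case True
  then have "colourable V 3"
    using cluster_outside_of_edge colourable_of_cluster_outside[OF _ subset_refl] K_max assms by auto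
  then show ?thesis using colourable_mono[of V 3 6] by simp
next
  case False
  obtain a b c where abc: "K = {a, b, c}" "a \<noteq> b" "a \<noteq> c" "b \<noteq> c"
    using assms by (auto simp: card_3_iff)
  let ?R = "{v \<in> V. \<not> b \<sim> v \<and> \<not> c \<sim> v}"
  have bc: "b \<sim> c" using abc K_adj by simp
  have RK: "?R \<inter> K = {}" using abc K_adj bc adj_sym by blast
  have RA0: "v \<in> A0" if "v \<in> ?R" "\<not> a \<sim> v" for v
    using that RK abc adj_sym unfolding A0_def by blast
  \<comment> \<open>In a triangle of \<open>?R\<close> at most one vertex misses \<open>a\<close>,
    since such vertices lie in the independent set \<open>A0\<close>. The other two force the third
    to be adjacent to \<open>a\<close>, giving a clique of size 4.\<close>
  have "cliques_le ?R 2"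
    unfolding cliques_le_def
  proof (intro allI impI, rule ccontr)
    fix T assume T: "T \<subseteq> ?R" "clq T" "\<not> card T \<le> 2"
    then have "3 \<le> card T" by simp
    then obtain T' where "T' \<subseteq> T" "card T' = 3" by (rule obtain_subset_with_card_n) auto
    then obtain x y z where xyz: "x \<in> T" "y \<in> T" "z \<in> T" "x \<noteq> y" "x \<noteq> z" "y \<noteq> z"
      by (auto simp: card_3_iff)
    have adj: "u \<sim> v" if "u \<in> T" "v \<in> T" "u \<noteq> v" for u v
      using that T(2) unfolding clique_def by blast
    have notA0: "a \<sim> u \<or> a \<sim> v" if "u \<in> T" "v \<in> T" "u \<noteq> v" for u v
      using False adj[OF that] RA0 that T(1) by blast
    have all: "a \<sim> w" if "u \<in> T" "v \<in> T" "w \<in> T" "u \<noteq> v" "a \<sim> u" "a \<sim> v" for u v w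
    proof (cases "w = u \<or> w = v")
      case False
      have "a \<notin> T" using T(1) RK abc by blast
      then show ?thesis
        using False that adj[of u v] adj[of u w] adj[of v w] adj_sym diamond_closed[of u v a w] by blast
    qed (use that in auto)
    have "a \<sim> x \<and> a \<sim> y \<and> a \<sim> z" using notA0 all xyz by metis
    then have "clq {a, x, y, z}" using xyz adj adj_sym unfolding clique_def by blast
    moreover have "{a, x, y, z} \<subseteq> V" using xyz T abc K_sub by blast
    ultimately have "card {a, x, y, z} \<le> 3" using K_max assms unfolding cliques_le_def by auto
    moreover have "a \<notin> {x, y, z}" using xyz T(1) RK abc by blast
    ultimately show False using xyz by simp
  qed
  then have "colourable ?R 2"
    by (intro cluster_colourable[OF _ cluster_nonneighbours[OF bc]]) auto
  moreover have "colourable {v. x \<sim> v} 2" for x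
    using neighbours_colourable[of 2] K_max assms by simp
  ultimately have "colourable ({v. b \<sim> v} \<union> {v. c \<sim> v} \<union> ?R) (2 + 2 + 2)"
    by (intro colourable_Un) auto
  then have "colourable ({v. b \<sim> v} \<union> {v. c \<sim> v} \<union> ?R) 6" by simp
  then show ?thesis by (rule colourable_subset) blast
qed

section \<open>The case \<omega> = 4: degree bounds for the greedy colouring\<close>

lemma clique_neighbours_card:
  assumes "S \<subseteq> {w. v \<sim> w}" "clq S" "v \<in> V"
  shows "card S < card K"
proof -
  have "clq (insert v S)" using assms clique_insert by blast
  moreover have SV: "insert v S \<subseteq> V" using assms adj_in_V by blast
  ultimately have "card (insert v S) \<le> card K" using K_max unfolding cliques_le_def by blast
  moreover have "v \<notin> S" "finite S" using assms SV finite_subset[OF _ finite_V] by auto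
  ultimately show ?thesis by simp
qed

lemma colourable_5_of_card_4:
  assumes "card K = 4"
  shows "colourable V 5"
proof (cases "\<exists>y\<in>A0. \<exists>z\<in>A0. y \<sim> z")
  case True
  then have "colourable V 4"
    using cluster_outside_of_edge colourable_of_cluster_outside[OF _ subset_refl] K_max assms by auto
  then show ?thesis using colourable_mono[of V 4 5] by simp
next
  case False
  define A where "A = V - K - A0"
  have "\<forall>v\<in>A. \<exists>k. k \<in> K \<and> v \<sim> k" unfolding A_def A0_def by blast
  then obtain n where n: "\<And>v. v \<in> A \<Longrightarrow> n v \<in> K \<and> v \<sim> n v"
    by (auto dest!: bchoice)
  have n_unique: "k = n v" if "v \<in> A" "k \<in> K" "v \<sim> k" for v k
    using neighbour_in_K_unique n that unfolding A_def by blast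
  \<comment> \<open>Vertices of \<open>A0\<close> touch nothing and each \<open>v\<close> in
    \<open>A\<close> touches only \<open>n v\<close>; if at most two of the four vertices of
    \<open>K\<close> are touched, two remain free.\<close>
  have P3: "x \<sim> z" if "x \<sim> y" "y \<sim> z" "x \<noteq> z" "x \<in> A \<union> A0" "y \<in> A \<union> A0" "z \<in> A \<union> A0"
      "n ` ({x, y, z} \<inter> A) \<subseteq> {i, j}" for x y z i j
  proof (rule P3_outside_closed[OF that(1-3)])
    show "touching {x, y, z} \<subseteq> {i, j}"
      using that(4-7) n_unique unfolding touching_def A0_def by blast
    have "card {i, j} \<le> 2" by (simp add: card_insert_if)
    then show "card {i, j} + 2 \<le> card K" using assms by simp
  qed simp
  have "cluster K" using K_clique unfolding cluster_def clique_def by blast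
  moreover have "card L \<le> 5" if "L \<subseteq> K" for L
    using card_mono[OF finite_K that] assms by simp
  then have "cliques_le K 5" unfolding cliques_le_def by blast
  ultimately have "colourable K 5" using cluster_colourable K_sub by blast
  moreover have "card {w \<in> K \<union> A. p \<sim> w} < 5" if p: "p \<in> A" for p
  proof (cases "\<exists>p'\<in>A. p \<sim> p' \<and> n p' = n p")
    case True
    then obtain p' where p': "p' \<in> A" "p \<sim> p'" "n p' = n p" by blast
    \<comment> \<open>The path \<open>p'\<close>, \<open>p\<close>, \<open>r\<close> touches only
      \<open>n p\<close> and \<open>n r\<close>, so \<open>p'\<close> and \<open>r\<close> are
      adjacent. Then \<open>r\<close> and \<open>n p\<close> are common neighbours of the edge
      \<open>{p, p'}\<close>. Hence the neighbours of \<open>p\<close> will form a clique.\<close>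
    have same: "n r = n p" if r: "r \<in> A" "p \<sim> r" for r
    proof (rule ccontr)
      assume neq: "n r \<noteq> n p"
      then have rp': "r \<noteq> p'" using p' by auto
      have "p' \<sim> r"
        using P3[of p' p r "n p" "n r"] p p' r rp' by (auto simp: insert_commute)
      then have "r \<sim> n p"
        using diamond_closed[of p p' r "n p"] n[OF p] n[OF p'(1)] p' r
        by (auto simp: A_def insert_commute)
      then show False using n_unique r n p neq by metis
    qed
    have "clq {w \<in> K \<union> A. p \<sim> w}"
      unfolding clique_def
    proof (intro ballI impI)
      fix u v assume uv: "u \<in> {w \<in> K \<union> A. p \<sim> w}" "v \<in> {w \<in> K \<union> A. p \<sim> w}" "u \<noteq> v"
      then have "u = n p \<or> (u \<in> A \<and> n u = n p)" "v = n p \<or> (v \<in> A \<and> n v = n p)"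
        using n_unique p same by auto
      moreover have "u \<sim> v" if "u \<in> A" "v \<in> A" "n u = n p" "n v = n p"
        using P3[of u p v "n p" "n p"] that uv p by (auto simp: insert_commute)
      ultimately show "u \<sim> v" using n uv(3) adj_sym by metis
    qed
    moreover have "p \<in> V" using p unfolding A_def by blast
    ultimately have "card {w \<in> K \<union> A. p \<sim> w} < card K"
      by (intro clique_neighbours_card) auto
    then show ?thesis using assms by simp
  next
    case False
    \<comment> \<open>Sending each neighbour of \<open>p\<close> to its vertex of \<open>K\<close>
      bounds the degree by 4.\<close>
    define g where "g w = (if w \<in> K then w else n w)" for w
    let ?N = "{w \<in> K \<union> A. p \<sim> w}"
    have "inj_on g ?N"
    proof (rule inj_onI, rule ccontr)
      fix u v assume uv: "u \<in> ?N" "v \<in> ?N" "g u = g v" "u \<noteq> v"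
      have np: "n w \<noteq> n p" if "w \<in> A" "p \<sim> w" for w using False that by blast
      have "u \<in> A \<and> v \<in> A"
        using uv np n_unique[OF p] unfolding g_def by (auto split: if_splits)
      then have A: "u \<in> A" "v \<in> A" "n u = n v" using uv unfolding g_def A_def by auto
      \<comment> \<open>Now \<open>p\<close> and \<open>n u\<close> are common neighbours of the
        edge \<open>{u, v}\<close>, so \<open>n u = n p\<close>, which this case excludes.\<close>
      have "u \<sim> v" using P3[of u p v "n u" "n p"] uv A p by (auto simp: insert_commute)
      moreover have "p \<noteq> n u" using p n[OF A(1)] unfolding A_def by auto
      ultimately have "p \<sim> n u"
        using diamond_closed[of u v p "n u"] n[OF A(1)] n[OF A(2)] A uv by (auto simp: insert_commute)
      then show False using n_unique[OF p] n A(1) np uv by blast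
    qed
    moreover have "g ` ?N \<subseteq> K" using n unfolding g_def by auto
    ultimately have "card ?N \<le> card K" using card_inj_on_le finite_K by blast
    then show ?thesis using assms by simp
  qed
  ultimately have "colourable (K \<union> A) 5"
    by (intro colourable_greedy) (auto simp: A_def)
  moreover have "card {w \<in> (K \<union> A) \<union> A0. q \<sim> w} < 5" if q: "q \<in> A0" for q
  proof -
    have inA: "w \<in> A" if "w \<in> (K \<union> A) \<union> A0" "q \<sim> w" for w
      using that q False unfolding A0_def by blast
    \<comment> \<open>A path through \<open>q\<close> touches at most two vertices of
      \<open>K\<close>, so the neighbourhood of \<open>q\<close> is a clique.\<close>
    have "u \<sim> v" if "u \<in> A" "v \<in> A" "q \<sim> u" "q \<sim> v" "u \<noteq> v" for u v
      using P3[of u q v "n u" "n v"] that q unfolding A_def by (auto simp: insert_commute)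
    then have "clq {w \<in> (K \<union> A) \<union> A0. q \<sim> w}"
      unfolding clique_def using inA by blast
    moreover have "q \<in> V" using q unfolding A0_def by blast
    ultimately have "card {w \<in> (K \<union> A) \<union> A0. q \<sim> w} < card K"
      by (intro clique_neighbours_card) auto
    then show ?thesis using assms by simp
  qed
  ultimately have "colourable ((K \<union> A) \<union> A0) 5"
    by (intro colourable_greedy[of "K \<union> A"]) (auto simp: A0_def)
  then show ?thesis by (rule colourable_subset) (auto simp: A_def)
qed

section \<open>The case \<omega> \<ge> 5 and the conclusion\<close>

lemma perfect_of_card_ge_5:
  assumes "5 \<le> card K"
  shows "perfect G"
  unfolding perfect_def
proof (intro allI impI)
  fix S assume "S \<subseteq> V"
  \<comment> \<open>Each \<open>S\<close> is coloured with its own clique number, while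
    \<open>K\<close> stays a maximum clique of \<open>G\<close>.\<close>
  then show "chromatic_number (induced G S) = clique_number (induced G S)"
    by (intro chromatic_eq_clique_number colourable_of_cluster_outside clique_number_bound
        cluster_outside_of_card_ge_5 assms)
qed

end

theorem theorem3:
  fixes G :: "'a graph"
  assumes "finite_simple_graph G"
    and "free_of (disjoint_union (path_graph 3) (path_graph 2)) G"
    and "free_of diamond G"
  shows "(clique_number G = 2 \<longrightarrow> chromatic_number G \<le> clique_number G + 2) \<and>
         (clique_number G = 3 \<longrightarrow> chromatic_number G \<le> clique_number G + 3) \<and>
         (clique_number G = 4 \<longrightarrow> chromatic_number G \<le> clique_number G + 1) \<and>
         (clique_number G \<ge> 5 \<longrightarrow> perfect G)"
proof -
  interpret P3P2_diamond_free G
    using assms by unfold_locales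
  obtain K where K: "K \<subseteq> V" "clq K" "card K = clique_number G"
    using clique_number_bound(2)[OF subset_refl] by (auto simp: induced_V)
  have max: "cliques_le V (clique_number G)"
    using clique_number_bound(1)[OF subset_refl] by (simp add: induced_V)
  interpret with_max_clique G K
    using K max by unfold_locales auto
  have le: "chromatic_number G \<le> k" if "colourable V k" for k
    using chromatic_number_le[OF that] by (simp add: induced_V)
  show ?thesis
    using le[of 4] le[of 6] le[of 5] colourable_4_of_triangle_free colourable_6_of_card_3
      colourable_5_of_card_4 perfect_of_card_ge_5 K(3) max by auto
qed

end
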